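(* Let $d\ge 1$ be an integer and let $0\le\varepsilon<\frac{2}{3d+5}$. Suppose $(p_1,q_1),\ldots,(p_k,q_k)$ are pairs of points in $\mathbb{R}^d$ such that $(p_i-q_i)^2=4$ for every $i\in\{1,\ldots,k\}$ and, for every $i,j\in\{1,\ldots,k\}$ with $i\ne j$, $$|(p_i-q_j)^2-2|\le\varepsilon,\qquad |(p_i-p_j)^2-2|\le\varepsilon,\qquad |(q_i-q_j)^2-2|\le\varepsilon.$$ Then $k\le d+2$.
   Context: For a vector $x\in\mathbb{R}^d$, $x^2=x\cdot x$ denotes the squared Euclidean norm, so $(p-q)^2$ is the squared Euclidean distance between $p$ and $q$. *)

theory Defs
  imports "HOL-Analysis.Analysis"
begin

end

(* The difference vectors w i = p i - q i have squared norm 4, and by polarization their mutual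
   inner products are at most 2 * eps in absolute value. So the Gram matrix of any d + 1 of them is
   strictly diagonally dominant, which would make them linearly independent in dimension d. *)
theory Submission
  imports Defs
begin

text \<open>In a vanishing combination, take the inner product with the vector whose coefficient is
  largest in absolute value: its diagonal term outweighs all the others together, so the sum cannot
  be zero.\<close>

lemma independent_if_gram_diagonally_dominant:
  fixes B :: "'a::real_inner set"
  assumes "finite B"
    and diag: "\<And>v. v \<in> B \<Longrightarrow> (\<Sum>w\<in>B - {v}. \<bar>v \<bullet> w\<bar>) < v \<bullet> v"
  shows "independent B"
proof
  assume "dependent B"
  then obtain c v where v: "v \<in> B" "c v \<noteq> 0" and zero: "(\<Sum>w\<in>B. c w *\<^sub>R w) = 0"
    using \<open>finite B\<close> by (auto simp: dependent_finite)
  obtain m where m: "m \<in> B" and "Max ((\<lambda>w. \<bar>c w\<bar>) ` B) = \<bar>c m\<bar>"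
    using Max_in[of "(\<lambda>w. \<bar>c w\<bar>) ` B"] \<open>finite B\<close> v(1) by fastforce
  then have max: "\<bar>c w\<bar> \<le> \<bar>c m\<bar>" if "w \<in> B" for w
    using Max_ge[of "(\<lambda>w. \<bar>c w\<bar>) ` B"] \<open>finite B\<close> that by fastforce
  \<comment> \<open>This keeps \<open>diag\<close> strict after scaling by
    \<open>\<bar>c m\<bar>\<close>.\<close>
  have "c m \<noteq> 0"
    using max[OF v(1)] v(2) by auto
  have "0 = m \<bullet> (\<Sum>w\<in>B. c w *\<^sub>R w)"
    using zero by simp
  also have "\<dots> = c m * (m \<bullet> m) + (\<Sum>w\<in>B - {m}. c w * (m \<bullet> w))"
    using \<open>finite B\<close> m by (simp add: inner_add_right inner_sum_right sum.remove)
  finally have "\<bar>c m * (m \<bullet> m)\<bar> = \<bar>\<Sum>w\<in>B - {m}. c w * (m \<bullet> w)\<bar>"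
    by linarith
  then have "\<bar>c m\<bar> * (m \<bullet> m) = \<bar>\<Sum>w\<in>B - {m}. c w * (m \<bullet> w)\<bar>"
    by (simp add: abs_mult)
  also have "\<dots> \<le> (\<Sum>w\<in>B - {m}. \<bar>c w * (m \<bullet> w)\<bar>)"
    by (rule sum_abs)
  also have "\<dots> \<le> (\<Sum>w\<in>B - {m}. \<bar>c m\<bar> * \<bar>m \<bullet> w\<bar>)"
    by (intro sum_mono) (auto simp: abs_mult intro: mult_right_mono max)
  also have "\<dots> < \<bar>c m\<bar> * (m \<bullet> m)"
    using diag[OF m] \<open>c m \<noteq> 0\<close> by (simp flip: sum_distrib_left)
  finally show False
    by simp
qed

text \<open>Among one more vector than the dimension, each Gram row has exactly
  \<open>DIM('a)\<close> off-diagonal entries, which is where the factor in \<open>less\<close>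
  comes from.\<close>

lemma card_le_DIM_if_almost_orthogonal:
  fixes w :: "'i \<Rightarrow> 'a::euclidean_space"
  assumes "finite I"
    and norm: "\<And>i. i \<in> I \<Longrightarrow> w i \<bullet> w i = r"
    and inner: "\<And>i j. i \<in> I \<Longrightarrow> j \<in> I \<Longrightarrow> i \<noteq> j \<Longrightarrow> \<bar>w i \<bullet> w j\<bar> \<le> \<delta>"
    and "0 \<le> \<delta>" and less: "real DIM('a) * \<delta> < r"
  shows "card I \<le> DIM('a)"
proof (rule ccontr)
  assume "\<not> card I \<le> DIM('a)"
  then obtain J where J: "J \<subseteq> I" "card J = Suc DIM('a)" "finite J"
    using obtain_subset_with_card_n[of "Suc DIM('a)" I] by auto
  \<comment> \<open>The dimension is at least 1, so a single off-diagonal entry is already below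
    \<open>r\<close>.\<close>
  have "1 * \<delta> \<le> real DIM('a) * \<delta>"
    using DIM_positive[where 'a='a] \<open>0 \<le> \<delta>\<close> by (intro mult_right_mono) linarith+
  with less have "\<delta> < r"
    by simp
  have inj: "inj_on w J"
  proof (rule inj_onI, rule ccontr)
    fix i j assume "i \<in> J" "j \<in> J" "w i = w j" "i \<noteq> j"
    then show False
      using norm[of j] inner[of i j] J(1) \<open>\<delta> < r\<close> by (auto simp: subset_iff)
  qed
  have "independent (w ` J)"
  proof (rule independent_if_gram_diagonally_dominant)
    fix v assume "v \<in> w ` J"
    then obtain i where i: "i \<in> J" "v = w i"
      by auto
    have "(\<Sum>u\<in>w ` J - {v}. \<bar>v \<bullet> u\<bar>) \<le> real (card (w ` J - {v})) * \<delta>"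
      using i J(1) by (intro sum_bounded_above) (auto intro!: inner)
    also have "card (w ` J - {v}) = DIM('a)"
      using i J inj by (simp add: card_image)
    finally show "(\<Sum>u\<in>w ` J - {v}. \<bar>v \<bullet> u\<bar>) < v \<bullet> v"
      using less norm[of i] i J(1) by auto
  qed (use J in simp)
  then have "card (w ` J) \<le> DIM('a)"
    using independent_bound by blast
  then show False
    using J inj by (simp add: card_image)
qed

text \<open>Each point occurs once with each sign on the right, so the squares cancel and only mixed
  products remain.\<close>

lemma inner_diff_diff_eq_norms:
  fixes a b c d :: "'a::real_inner"
  shows "2 * ((a - b) \<bullet> (c - d)) =
    (norm (a - d))\<^sup>2 + (norm (c - b))\<^sup>2 - (norm (a - c))\<^sup>2 - (norm (b - d))\<^sup>2"
  by (simp add: power2_norm_eq_inner inner_diff_left inner_diff_right inner_commute)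

theorem claim4p1:
  fixes p q :: "nat \<Rightarrow> real ^ 'd::finite"
    and k :: nat
    and \<epsilon> :: real
  assumes "0 \<le> \<epsilon>" and "\<epsilon> < 2 / (3 * real CARD('d) + 5)"
    and "\<And>i. i \<in> {1..k} \<Longrightarrow> (norm (p i - q i))\<^sup>2 = 4"
    and "\<And>i j. i \<in> {1..k} \<Longrightarrow> j \<in> {1..k} \<Longrightarrow> i \<noteq> j \<Longrightarrow>
           \<bar>(norm (p i - q j))\<^sup>2 - 2\<bar> \<le> \<epsilon> \<and>
           \<bar>(norm (p i - p j))\<^sup>2 - 2\<bar> \<le> \<epsilon> \<and>
           \<bar>(norm (q i - q j))\<^sup>2 - 2\<bar> \<le> \<epsilon>"
  shows "k \<le> CARD('d) + 2"
proof -
  \<comment> \<open>The argument yields k \<le> d, from which the stated bound follows at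
    once.\<close>
  have "card {1..k} \<le> DIM(real ^ 'd)"
  proof (rule card_le_DIM_if_almost_orthogonal)
    show "(p i - q i) \<bullet> (p i - q i) = 4" if "i \<in> {1..k}" for i
      using assms(3)[OF that] by (simp add: power2_norm_eq_inner)
    show "\<bar>(p i - q i) \<bullet> (p j - q j)\<bar> \<le> 2 * \<epsilon>"
      if "i \<in> {1..k}" "j \<in> {1..k}" "i \<noteq> j" for i j
      \<comment> \<open>The four squared distances are 2 up to \<open>\<epsilon>\<close>. The 2s
        cancel, leaving an error of at most \<open>4 * \<epsilon>\<close> in twice the inner
        product.\<close>
      using assms(4)[of i j] assms(4)[of j i] that inner_diff_diff_eq_norms[of "p i" "q i" "p j" "q j"]
      unfolding abs_le_iff by linarith
    \<comment> \<open>With denominators cleared, d * \<open>\<epsilon>\<close> < 2/3, so 2 * d *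
      \<open>\<epsilon>\<close> < 4/3 < 4.\<close>
    have "3 * (real CARD('d) * \<epsilon>) + 5 * \<epsilon> < 2"
      using assms(2) by (simp add: field_simps add_pos_nonneg)
    then show "real DIM(real ^ 'd) * (2 * \<epsilon>) < 4"
      using \<open>0 \<le> \<epsilon>\<close> mult_nonneg_nonneg[of "real CARD('d)" \<epsilon>] by (simp add: mult.commute)
  qed (use \<open>0 \<le> \<epsilon>\<close> in auto)
  then show ?thesis
    by simp
qed

end
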